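(* Consider an admissible protograph-based batched network code (P-BNC) constructed from a protograph $\mathbf{B}$ with $n_v$ variable-node types, batch size $M$, field order $q$, and set of possible rank distributions $\mathcal{H}_{\mathcal{D}}$. Let $$\mathcal{C}_0=\Big\{C\in[0,M]:\ \lim_{\ell_{\max}\to\infty}z_j^{(\ell_{\max})}(\mathbf{h})=0\ \text{ for all } j=1,\dots,n_v \text{ and all } \mathbf{h}\in\mathcal{H}_{\mathcal{D}}(C)\Big\},$$ where $z_j^{(\ell_{\max})}(\mathbf{h})$ is the a posteriori erasure probability produced by density evolution with rank distribution $\mathbf{h}$. If $C'\in\mathcal{C}_0$, then $C\in\mathcal{C}_0$ for all $C$ with $C'<C\le M$.
   Context: Rank distributions. A rank distribution is a probability vector $\mathbf{h}=(h_0,\dots,h_M)$. $\mathcal{H}_{\mathcal{D}}$ is the set of all rank distributions (distributions of the rank of the end-to-end transfer matrix of a batch) that can occur at the destination nodes $t\in\mathcal{D}$ of the network as the channel erasure probabilities vary. Only this set matters here. For real $C$, $\mathcal{H}_{\mathcal{D}}(C)=\{\mathbf{h}\in\mathcal{H}_{\mathcal{D}}:\sum_{r=1}^M r h_r=C\}$. Write $\mathbf{h}'\preceq\mathbf{h}$ if $\sum_{i=k}^M h_i'\le\sum_{i=k}^M h_i$ for all $k=0,1,\dots,M$. Admissible. The P-BNC is admissible if for any real numbers $0\le C'\le C$ and any $\mathbf{h}\in\mathcal{H}_{\mathcal{D}}(C)$ there exists $\mathbf{h}'\in\mathcal{H}_{\mathcal{D}}(C')$ with $\mathbf{h}'\preceq\mathbf{h}$.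 Protograph. $\mathbf{B}=[b_{i,j}]_{1\le i\le n_c,1\le j\le n_v}$ is a matrix of non-negative integers whose first $n_c^{(1)}$ rows correspond to LDPC check nodes (L-CNs) and whose remaining rows $n_c^{(1)}+1,\dots,n_c$ correspond to batch check nodes (B-CNs). Columns correspond to variable nodes. Let $d_{c_i}=\sum_j b_{i,j}$, $\tilde{\mathcal{N}}_c(i)=\{j:b_{i,j}>0\}$, $\tilde{\mathcal{N}}_v(j)=\{i:b_{i,j}>0\}$. Density evolution for a given $\mathbf{h}$. Let $\zeta_0^m=1$ and $\zeta_r^m=(1-q^{-m})(1-q^{-m+1})\cdots(1-q^{-m+r-1})$ for $r>0$. Set $x_{i,j}^{(0)}=1$ for all $i,j$. If $b_{i,j}=0$, then $x_{i,j}^{(\ell)}$ and $y_{i,j}^{(\ell)}$ are fixed to $1$. For $\ell\ge1$ and $b_{i,j}>0$: L-CN update ($1\le i\le n_c^{(1)}$): $$y_{i,j}^{(\ell)}=1-\Big(\prod_{j'\in\tilde{\mathcal{N}}_c(i)\setminus\{j\}}(1-x_{i,j'}^{(\ell-1)})^{b_{i,j'}}\Big)(1-x_{i,j}^{(\ell-1)})^{b_{i,j}-1}.$$ B-CN update ($n_c^{(1)}+1\le i\le n_c$): $$y_{i,j}^{(\ell)}=1-\sum_{r=1}^M h_r\sum_{s=0}^{\min\{d_{c_i}-1,r-1\}}\Omega(i,j,s,\mathbf{x}_i^{(\ell-1)})\,\zeta_{s+1}^r,\qquad \mathbf{x}_i^{(\ell)}=(x_{i,1}^{(\ell)},\dots,x_{i,n_v}^{(\ell)}),$$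 where, for $\mathbf{x}=(x_1,\dots,x_{n_v})$, $\Omega(i,j,s,\mathbf{x})$ is the probability that exactly $s$ out of $d_{c_i}-1$ independent messages are erased, where $b_{i,j'}$ of the messages are each erased with probability $x_{j'}$ for every $j'\in\tilde{\mathcal{N}}_c(i)\setminus\{j\}$, and $b_{i,j}-1$ of them are each erased with probability $x_j$; explicitly, $$\Omega(i,j,s,\mathbf{x})=\sum\ \Big[\prod_{j'\in\tilde{\mathcal{N}}_c(i)\setminus\{j\}}\binom{b_{i,j'}}{k_{j'}}x_{j'}^{k_{j'}}(1-x_{j'})^{b_{i,j'}-k_{j'}}\Big]\binom{b_{i,j}-1}{k_j}x_j^{k_j}(1-x_j)^{b_{i,j}-1-k_j},$$ the sum being over all integers $0\le k_{j'}\le b_{i,j'}$ ($j'\in\tilde{\mathcal{N}}_c(i)\setminus\{j\}$) and $0\le k_j\le b_{i,j}-1$ with $\sum_{l\in\tilde{\mathcal{N}}_c(i)}k_l=s$ (convention $0^0=1$). VN update: $$x_{i,j}^{(\ell)}=\Big(\prod_{i'\in\tilde{\mathcal{N}}_v(j)\setminus\{i\}}(y_{i',j}^{(\ell)})^{b_{i',j}}\Big)(y_{i,j}^{(\ell)})^{b_{i,j}-1}.$$ A posteriori erasure probability after $\ell_{\max}$ iterations: $$z_j^{(\ell_{\max})}=\prod_{i\in\tilde{\mathcal{N}}_v(j)}(y_{i,j}^{(\ell_{\max})})^{b_{i,j}}.$$ $z_j^{(\ell_{\max})}(\mathbf{h})$ denotes this quantity when the rank distribution is $\mathbf{h}$.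 *)

theory Defs
  imports
    "HOL-Analysis.Analysis"
    "HOL-Number_Theory.Prime_Powers"
    "Jordan_Normal_Form.Matrix"
begin

text \<open>
  A rank distribution \<open>(h\<^sub>0, \<dots>, h\<^sub>M)\<close> is a function \<open>nat \<Rightarrow> real\<close>. It is required to vanish
  beyond \<open>M\<close>, so that functions correspond one-to-one to vectors.
\<close>

definition rank_distribution :: "nat \<Rightarrow> (nat \<Rightarrow> real) \<Rightarrow> bool" where
  "rank_distribution M h \<longleftrightarrow>
     (\<forall>r\<le>M. 0 \<le> h r) \<and> (\<Sum>r=0..M. h r) = 1 \<and> (\<forall>r>M. h r = 0)"

definition rank_dists_at :: "nat \<Rightarrow> (nat \<Rightarrow> real) set \<Rightarrow> real \<Rightarrow> (nat \<Rightarrow> real) set" where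
  "rank_dists_at M H C = {h \<in> H. (\<Sum>r=1..M. real r * h r) = C}"

definition rank_le :: "nat \<Rightarrow> (nat \<Rightarrow> real) \<Rightarrow> (nat \<Rightarrow> real) \<Rightarrow> bool" where
  "rank_le M h' h \<longleftrightarrow> (\<forall>k\<le>M. (\<Sum>i=k..M. h' i) \<le> (\<Sum>i=k..M. h i))"

definition admissible :: "nat \<Rightarrow> (nat \<Rightarrow> real) set \<Rightarrow> bool" where
  "admissible M H \<longleftrightarrow>
     (\<forall>C' C :: real. 0 \<le> C' \<and> C' \<le> C \<longrightarrow>
        (\<forall>h \<in> rank_dists_at M H C. \<exists>h' \<in> rank_dists_at M H C'. rank_le M h' h))"

text \<open>
  A protograph is a matrix \<open>B\<close> of natural numbers, together with the number \<open>L\<close> of its leading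
  rows that are LDPC check nodes; the rows \<open>L, \<dots>, dim_row B - 1\<close> are batch check nodes.
  Row and column indices start at 0, as is usual for this matrix type.
\<close>

definition check_degree :: "nat mat \<Rightarrow> nat \<Rightarrow> nat" where
  "check_degree B i = (\<Sum>j<dim_col B. B $$ (i, j))"

definition check_nbrs :: "nat mat \<Rightarrow> nat \<Rightarrow> nat set" where
  "check_nbrs B i = {j. j < dim_col B \<and> B $$ (i, j) > 0}"

definition var_nbrs :: "nat mat \<Rightarrow> nat \<Rightarrow> nat set" where
  "var_nbrs B j = {i. i < dim_row B \<and> B $$ (i, j) > 0}"

text \<open>\<open>zeta_coeff q m r\<close> is \<open>\<zeta>\<^sub>r\<^sup>m\<close>, the superscript \<open>m\<close> being an index and not an exponent.\<close>

definition zeta_coeff :: "nat \<Rightarrow> nat \<Rightarrow> nat \<Rightarrow> real" where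
  "zeta_coeff q m r = (\<Prod>k<r. 1 - real q powi (int k - int m))"

text \<open>
  \<open>erasure_counts B i j s\<close> is the range of the summation in \<open>\<Omega>(i,j,s,x)\<close>: the choices of the
  number \<open>k l\<close> of erased messages from each neighbouring variable node \<open>l\<close>, with \<open>s\<close> erasures
  in total. One of the messages from \<open>j\<close> is left out, being the one on the outgoing edge.
\<close>

definition erasure_counts :: "nat mat \<Rightarrow> nat \<Rightarrow> nat \<Rightarrow> nat \<Rightarrow> (nat \<Rightarrow> nat) set" where
  "erasure_counts B i j s =
     {k \<in> (\<Pi>\<^sub>E l\<in>check_nbrs B i. {0..(if l = j then B $$ (i, l) - 1 else B $$ (i, l))}).
        (\<Sum>l\<in>check_nbrs B i. k l) = s}"

definition Omega :: "nat mat \<Rightarrow> nat \<Rightarrow> nat \<Rightarrow> nat \<Rightarrow> (nat \<Rightarrow> real) \<Rightarrow> real" where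
  "Omega B i j s x =
     (\<Sum>k\<in>erasure_counts B i j s.
        (\<Prod>j'\<in>check_nbrs B i - {j}.
            real (B $$ (i, j') choose k j') * x j' ^ k j' * (1 - x j') ^ (B $$ (i, j') - k j'))
        * (real ((B $$ (i, j) - 1) choose k j) * x j ^ k j * (1 - x j) ^ (B $$ (i, j) - 1 - k j)))"

definition lcn_update :: "nat mat \<Rightarrow> (nat \<Rightarrow> nat \<Rightarrow> real) \<Rightarrow> nat \<Rightarrow> nat \<Rightarrow> real" where
  "lcn_update B x i j =
     1 - (\<Prod>j'\<in>check_nbrs B i - {j}. (1 - x i j') ^ B $$ (i, j'))
         * (1 - x i j) ^ (B $$ (i, j) - 1)"

definition bcn_update ::
  "nat mat \<Rightarrow> nat \<Rightarrow> nat \<Rightarrow> (nat \<Rightarrow> real) \<Rightarrow> (nat \<Rightarrow> nat \<Rightarrow> real) \<Rightarrow> nat \<Rightarrow> nat \<Rightarrow> real" where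
  "bcn_update B M q h x i j =
     1 - (\<Sum>r=1..M. h r *
            (\<Sum>s=0..min (check_degree B i - 1) (r - 1).
               Omega B i j s (x i) * zeta_coeff q r (s + 1)))"

definition cn_update ::
  "nat mat \<Rightarrow> nat \<Rightarrow> nat \<Rightarrow> nat \<Rightarrow> (nat \<Rightarrow> real) \<Rightarrow> (nat \<Rightarrow> nat \<Rightarrow> real) \<Rightarrow> nat \<Rightarrow> nat \<Rightarrow> real" where
  "cn_update B L M q h x i j =
     (if B $$ (i, j) = 0 then 1
      else if i < L then lcn_update B x i j
      else bcn_update B M q h x i j)"

definition vn_update :: "nat mat \<Rightarrow> (nat \<Rightarrow> nat \<Rightarrow> real) \<Rightarrow> nat \<Rightarrow> nat \<Rightarrow> real" where
  "vn_update B y i j =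
     (if B $$ (i, j) = 0 then 1
      else (\<Prod>i'\<in>var_nbrs B j - {i}. y i' j ^ B $$ (i', j)) * y i j ^ (B $$ (i, j) - 1))"

primrec de_x ::
  "nat mat \<Rightarrow> nat \<Rightarrow> nat \<Rightarrow> nat \<Rightarrow> (nat \<Rightarrow> real) \<Rightarrow> nat \<Rightarrow> nat \<Rightarrow> nat \<Rightarrow> real" where
  "de_x B L M q h 0 = (\<lambda>i j. 1)"
| "de_x B L M q h (Suc l) = vn_update B (cn_update B L M q h (de_x B L M q h l))"

text \<open>The sequences \<open>y\<close> and \<open>z\<close> are only meaningful from index \<open>l = 1\<close> on.\<close>

definition de_y ::
  "nat mat \<Rightarrow> nat \<Rightarrow> nat \<Rightarrow> nat \<Rightarrow> (nat \<Rightarrow> real) \<Rightarrow> nat \<Rightarrow> nat \<Rightarrow> nat \<Rightarrow> real" where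
  "de_y B L M q h l = cn_update B L M q h (de_x B L M q h (l - 1))"

definition de_z ::
  "nat mat \<Rightarrow> nat \<Rightarrow> nat \<Rightarrow> nat \<Rightarrow> (nat \<Rightarrow> real) \<Rightarrow> nat \<Rightarrow> nat \<Rightarrow> real" where
  "de_z B L M q h l j = (\<Prod>i\<in>var_nbrs B j. de_y B L M q h l i j ^ B $$ (i, j))"

definition decodable_set ::
  "nat mat \<Rightarrow> nat \<Rightarrow> nat \<Rightarrow> nat \<Rightarrow> (nat \<Rightarrow> real) set \<Rightarrow> real set" where
  "decodable_set B L M q H =
     {C \<in> {0..real M}. \<forall>j<dim_col B. \<forall>h\<in>rank_dists_at M H C.
        (\<lambda>l. de_z B L M q h l j) \<longlonglongrightarrow> 0}"

end

theory Submission
  imports Defs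
begin

text \<open>
  Conditioned on the rank \<open>r\<close>, a batch check node recovers an edge with probability
  \<open>E[\<zeta>\<^sub>S\<^sub>+\<^sub>1\<^sup>r]\<close>, where the number \<open>S\<close> of erased other messages is a sum of independent binomial
  variables. Since \<open>\<zeta>\<^sub>s\<^sub>+\<^sub>1\<^sup>r\<close> decreases in \<open>s\<close> and increases in \<open>r\<close>, this probability decreases in
  every erasure probability and increases in \<open>r\<close>, and summation by parts over \<open>r\<close> shows that the
  update is monotone for the order on rank distributions. Hence all quantities of density
  evolution under \<open>h\<close> are bounded by those under any \<open>h'\<close> with \<open>rank_le M h' h\<close>, and
  admissibility supplies such an \<open>h'\<close> at the smaller value \<open>C'\<close>.
\<close>

section \<open>Expectations over binomial variables\<close>

definition binom_weight :: "nat \<Rightarrow> real \<Rightarrow> nat \<Rightarrow> real" where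
  "binom_weight n p k = real (n choose k) * p ^ k * (1 - p) ^ (n - k)"

lemma binom_weight_nonneg:
  assumes "0 \<le> p" "p \<le> 1"
  shows "0 \<le> binom_weight n p k"
  using assms by (simp add: binom_weight_def)

definition binom_expect :: "nat \<Rightarrow> real \<Rightarrow> (nat \<Rightarrow> real) \<Rightarrow> real" where
  "binom_expect n p \<phi> = (\<Sum>k=0..n. binom_weight n p k * \<phi> k)"

lemma binom_expect_0 [simp]: "binom_expect 0 p \<phi> = \<phi> 0"
  by (simp add: binom_expect_def binom_weight_def)

text \<open>Condition on one trial: a success, with probability \<open>p\<close>, shifts the
  argument of \<open>\<phi>\<close>. The coefficients agree by Pascal's rule.\<close>

lemma binom_expect_Suc:
  "binom_expect (Suc n) p \<phi> =
     (1 - p) * binom_expect n p \<phi> + p * binom_expect n p (\<lambda>k. \<phi> (Suc k))"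
proof -
  have "(1 - p) * binom_expect n p \<phi> =
      (\<Sum>k\<le>n. real (n choose k) * p ^ k * (1 - p) ^ (Suc n - k) * \<phi> k)"
    unfolding binom_expect_def binom_weight_def sum_distrib_left atLeast0AtMost
    by (intro sum.cong refl) (simp add: Suc_diff_le)
  \<comment> \<open>The added term \<open>k = Suc n\<close> vanishes because
    \<open>n choose Suc n = 0\<close>.\<close>
  also have "\<dots> = (\<Sum>k\<le>Suc n. real (n choose k) * p ^ k * (1 - p) ^ (Suc n - k) * \<phi> k)"
    by simp
  also have "\<dots> = (1 - p) ^ Suc n * \<phi> 0 +
      (\<Sum>k\<le>n. real (n choose Suc k) * p ^ Suc k * (1 - p) ^ (n - k) * \<phi> (Suc k))"
    by (simp only: sum.atMost_Suc_shift) simp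
  finally have 1: "(1 - p) * binom_expect n p \<phi> = \<dots>" .
  have 2: "p * binom_expect n p (\<lambda>k. \<phi> (Suc k)) =
      (\<Sum>k\<le>n. real (n choose k) * p ^ Suc k * (1 - p) ^ (n - k) * \<phi> (Suc k))"
    unfolding binom_expect_def binom_weight_def sum_distrib_left atLeast0AtMost
    by (intro sum.cong refl) simp
  have "binom_expect (Suc n) p \<phi> = (1 - p) ^ Suc n * \<phi> 0 +
      (\<Sum>k\<le>n. real (Suc n choose Suc k) * p ^ Suc k * (1 - p) ^ (n - k) * \<phi> (Suc k))"
    unfolding binom_expect_def binom_weight_def atLeast0AtMost
    by (simp only: sum.atMost_Suc_shift) simp
  then show ?thesis
    unfolding 1 2 by (simp add: sum.distrib[symmetric] algebra_simps)
qed

lemma binom_expect_const: "binom_expect n p (\<lambda>_. c) = c"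
  by (induction n) (simp_all add: binom_expect_Suc algebra_simps)

lemma binom_expect_mono:
  assumes "0 \<le> p" "p \<le> 1" "\<And>k. \<phi> k \<le> \<psi> k"
  shows "binom_expect n p \<phi> \<le> binom_expect n p \<psi>"
  unfolding binom_expect_def
  using assms by (intro sum_mono mult_left_mono binom_weight_nonneg) auto

text \<open>A larger success probability makes the count stochastically larger. The induction keeps
  \<open>\<phi>\<close> arbitrary because the recurrence also involves its shift.\<close>

lemma binom_expect_antimono:
  assumes "0 \<le> p" "p \<le> p'" "p' \<le> 1" "antimono \<phi>"
  shows "binom_expect n p' \<phi> \<le> binom_expect n p \<phi>"
  using assms(4)
proof (induction n arbitrary: \<phi>)
  case 0
  then show ?case by simp
next
  case (Suc n)
  let ?\<psi> = "\<lambda>k. \<phi> (Suc k)"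
  have anti: "antimono ?\<psi>"
    using Suc.prems by (auto simp: antimono_def)
  have le: "binom_expect n p' ?\<psi> \<le> binom_expect n p' \<phi>"
    using assms Suc.prems by (intro binom_expect_mono) (auto simp: antimono_def)
  \<comment> \<open>Writing \<open>p' = p + (p' - p)\<close> isolates a subtracted term, which is
    nonnegative because shifting an antitone \<open>\<phi>\<close> lowers its expectation.\<close>
  have "binom_expect (Suc n) p' \<phi> =
      (1 - p) * binom_expect n p' \<phi> + p * binom_expect n p' ?\<psi>
      - (p' - p) * (binom_expect n p' \<phi> - binom_expect n p' ?\<psi>)"
    by (simp add: binom_expect_Suc algebra_simps)
  also have "\<dots> \<le> (1 - p) * binom_expect n p' \<phi> + p * binom_expect n p' ?\<psi>"
    using le assms by simp
  also have "\<dots> \<le> (1 - p) * binom_expect n p \<phi> + p * binom_expect n p ?\<psi>"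
    using assms Suc.IH[OF Suc.prems] Suc.IH[OF anti] by (intro add_mono mult_left_mono) auto
  finally show ?case by (simp add: binom_expect_Suc)
qed

text \<open>The expectation of \<open>\<phi>\<close> at a sum of independent binomial counts indexed
  by \<open>A\<close>. Summing over whole count vectors matches the summation in
  \<open>Omega\<close>.\<close>

definition count_expect ::
  "'a set \<Rightarrow> ('a \<Rightarrow> nat) \<Rightarrow> ('a \<Rightarrow> real) \<Rightarrow> (nat \<Rightarrow> real) \<Rightarrow> real" where
  "count_expect A n x \<phi> =
     (\<Sum>k\<in>(\<Pi>\<^sub>E l\<in>A. {0..n l}). (\<Prod>l\<in>A. binom_weight (n l) (x l) (k l)) * \<phi> (\<Sum>l\<in>A. k l))"

lemma count_expect_empty [simp]: "count_expect {} n x \<phi> = \<phi> 0"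
  by (simp add: count_expect_def)

lemma count_expect_insert:
  assumes "finite A" "a \<notin> A"
  shows "count_expect (insert a A) n x \<phi> =
    binom_expect (n a) (x a) (\<lambda>m. count_expect A n x (\<lambda>s. \<phi> (m + s)))"
proof -
  let ?w = "\<lambda>A k. \<Prod>l\<in>A. binom_weight (n l) (x l) (k l)"
  let ?P = "\<Pi>\<^sub>E l\<in>A. {0..n l}"
  have w: "?w A (k(a := m)) = ?w A k" and s: "(\<Sum>l\<in>A. (k(a := m)) l) = (\<Sum>l\<in>A. k l)"
    for k :: "'a \<Rightarrow> nat" and m
    using assms by (auto intro!: prod.cong sum.cong)
  \<comment> \<open>Count vectors on \<open>insert a A\<close> are the updates
    \<open>k(a := m)\<close>, and \<open>(m, k)\<close> can be read off from the update since
    \<open>a\<close> lies outside \<open>A\<close>.\<close>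
  have "count_expect (insert a A) n x \<phi> =
      (\<Sum>(m, k)\<in>{0..n a} \<times> ?P. ?w (insert a A) (k(a := m)) *
        \<phi> (\<Sum>l\<in>insert a A. (k(a := m)) l))"
    unfolding count_expect_def PiE_insert_eq
    using assms by (subst sum.reindex[OF inj_combinator]) (simp_all add: case_prod_unfold)
  also have "\<dots> = (\<Sum>(m, k)\<in>{0..n a} \<times> ?P. binom_weight (n a) (x a) m * (?w A k *
        \<phi> (m + (\<Sum>l\<in>A. k l))))"
    unfolding prod.insert[OF assms] sum.insert[OF assms] w s by (simp add: mult.assoc)
  finally show ?thesis
    by (simp add: binom_expect_def count_expect_def sum.cartesian_product sum_distrib_left)
qed

lemma count_expect_const:
  assumes "finite A"
  shows "count_expect A n x (\<lambda>_. c) = c"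
  using assms by induction (simp_all add: count_expect_insert binom_expect_const)

lemma count_expect_mono:
  assumes "finite A" "\<And>l. l \<in> A \<Longrightarrow> 0 \<le> x l" "\<And>l. l \<in> A \<Longrightarrow> x l \<le> 1" "\<And>s. \<phi> s \<le> \<psi> s"
  shows "count_expect A n x \<phi> \<le> count_expect A n x \<psi>"
  unfolding count_expect_def
  using assms by (intro sum_mono mult_left_mono prod_nonneg binom_weight_nonneg) auto

text \<open>The induction step changes the probability at \<open>a\<close> while the others are
  still given by \<open>x'\<close>, and then changes those inside the outer expectation.\<close>

lemma count_expect_antimono:
  assumes "finite A" "antimono \<phi>"
    and "\<And>l. l \<in> A \<Longrightarrow> 0 \<le> x l" "\<And>l. l \<in> A \<Longrightarrow> x l \<le> x' l" "\<And>l. l \<in> A \<Longrightarrow> x' l \<le> 1"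
  shows "count_expect A n x' \<phi> \<le> count_expect A n x \<phi>"
  using assms
proof (induction A arbitrary: \<phi> rule: finite_induct)
  case empty
  then show ?case by simp
next
  case (insert a A)
  have shift: "antimono (\<lambda>s. \<phi> (m + s))" for m
    using insert.prems(1) by (auto simp: antimono_def)
  have le1: "x l \<le> 1" if "l \<in> insert a A" for l
    using insert.prems(3,4)[OF that] by linarith
  have ge0: "0 \<le> x' l" if "l \<in> insert a A" for l
    using insert.prems(2,3)[OF that] by linarith
  \<comment> \<open>For each \<open>s\<close>, the value \<open>\<phi> (m + s)\<close> decreases in
    \<open>m\<close>, and expectation preserves this.\<close>
  have "antimono (\<lambda>m. count_expect A n x' (\<lambda>s. \<phi> (m + s)))"
    using insert.hyps insert.prems(1,4) ge0
    by (intro monotoneI count_expect_mono) (auto simp: antimono_def)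
  then have "binom_expect (n a) (x' a) (\<lambda>m. count_expect A n x' (\<lambda>s. \<phi> (m + s))) \<le>
      binom_expect (n a) (x a) (\<lambda>m. count_expect A n x' (\<lambda>s. \<phi> (m + s)))"
    using insert.prems by (intro binom_expect_antimono) auto
  also have "\<dots> \<le> binom_expect (n a) (x a) (\<lambda>m. count_expect A n x (\<lambda>s. \<phi> (m + s)))"
    using insert.prems le1 by (intro binom_expect_mono insert.IH shift) auto
  finally show ?case
    using insert.hyps by (simp add: count_expect_insert)
qed

section \<open>The rank coefficients\<close>

text \<open>The factor with \<open>k = r\<close> is \<open>1 - q ^ 0 = 0\<close>.\<close>

lemma zeta_coeff_eq_0:
  assumes "r < m" "0 < q"
  shows "zeta_coeff q r m = 0"
  using assms by (auto simp: zeta_coeff_def intro!: prod_zero bexI[of _ r])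

lemma zeta_factor_bounds:
  assumes "0 < q" "k \<le> r"
  shows "0 \<le> 1 - real q powi (int k - int r)" "1 - real q powi (int k - int r) \<le> 1"
proof -
  have "real q powi (int k - int r) \<le> real q powi 0"
    using assms by (intro power_int_increasing) auto
  then show "0 \<le> 1 - real q powi (int k - int r)" by simp
qed simp

text \<open>Factors with \<open>k > r\<close> may be negative, but a product reaching that far
  contains the zero factor at \<open>k = r\<close>. Otherwise all factors lie in [0,1].\<close>

lemma zeta_coeff_bounds:
  assumes "0 < q"
  shows "0 \<le> zeta_coeff q r m" "zeta_coeff q r m \<le> 1"
proof -
  have "0 \<le> zeta_coeff q r m \<and> zeta_coeff q r m \<le> 1"
  proof (cases "r < m")
    case True
    then show ?thesis using assms by (simp add: zeta_coeff_eq_0)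
  next
    case False
    then show ?thesis
      unfolding zeta_coeff_def
      using zeta_factor_bounds[OF assms] by (intro conjI prod_nonneg prod_le_1) auto
  qed
  then show "0 \<le> zeta_coeff q r m" "zeta_coeff q r m \<le> 1" by auto
qed

lemma zeta_coeff_antimono:
  assumes "0 < q"
  shows "antimono (\<lambda>m. zeta_coeff q r m)"
  unfolding antimono_iff_le_Suc
proof
  fix m
  show "zeta_coeff q r (Suc m) \<le> zeta_coeff q r m"
  proof (cases "r < Suc m")
    case True
    then show ?thesis using assms by (simp add: zeta_coeff_eq_0 zeta_coeff_bounds)
  next
    case False
    have "zeta_coeff q r (Suc m) = zeta_coeff q r m * (1 - real q powi (int m - int r))"
      by (simp add: zeta_coeff_def)
    also have "\<dots> \<le> zeta_coeff q r m * 1"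
      using assms False by (intro mult_left_mono zeta_coeff_bounds zeta_factor_bounds) auto
    finally show ?thesis by simp
  qed
qed

text \<open>For \<open>m \<le> r\<close> all factors are nonnegative and each one grows with the
  rank; for \<open>r < m\<close> the left side is 0.\<close>

lemma zeta_coeff_mono_rank:
  assumes "0 < q" "r \<le> r'"
  shows "zeta_coeff q r m \<le> zeta_coeff q r' m"
proof (cases "r < m")
  case True
  then show ?thesis using assms by (simp add: zeta_coeff_eq_0 zeta_coeff_bounds)
next
  case False
  have "real q powi (int k - int r') \<le> real q powi (int k - int r)" for k
    using assms by (intro power_int_increasing) auto
  then show ?thesis
    unfolding zeta_coeff_def
    using zeta_factor_bounds(1)[OF assms(1)] False by (intro prod_mono) auto
qed

section \<open>The check node updates\<close>

text \<open>Only one edge to \<open>j\<close>, the outgoing one, is excluded; edges parallel to it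
  still carry messages.\<close>

definition other_edges :: "nat mat \<Rightarrow> nat \<Rightarrow> nat \<Rightarrow> nat \<Rightarrow> nat" where
  "other_edges B i j l = (if l = j then B $$ (i, l) - 1 else B $$ (i, l))"

text \<open>The chance that a batch of rank \<open>r\<close> resolves the outgoing edge, written
  without the cut-off of \<open>s\<close> at \<open>r - 1\<close>.\<close>

definition recovery_prob :: "nat mat \<Rightarrow> nat \<Rightarrow> nat \<Rightarrow> nat \<Rightarrow> (nat \<Rightarrow> real) \<Rightarrow> nat \<Rightarrow> real" where
  "recovery_prob B q i j x r =
     count_expect (check_nbrs B i) (other_edges B i j) x (\<lambda>s. zeta_coeff q r (s + 1))"

section \<open>The batch update as an average of recovery probabilities\<close>

lemma finite_check_nbrs [simp]: "finite (check_nbrs B i)"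
  by (simp add: check_nbrs_def)

lemma finite_var_nbrs [simp]: "finite (var_nbrs B j)"
  by (simp add: var_nbrs_def)

lemma sum_other_edges:
  assumes "j \<in> check_nbrs B i"
  shows "(\<Sum>l\<in>check_nbrs B i. other_edges B i j l) = check_degree B i - 1"
proof -
  have "check_degree B i = (\<Sum>l\<in>check_nbrs B i. B $$ (i, l))"
    unfolding check_degree_def by (rule sum.mono_neutral_right) (auto simp: check_nbrs_def)
  also have "\<dots> = B $$ (i, j) + (\<Sum>l\<in>check_nbrs B i - {j}. B $$ (i, l))"
    using assms by (intro sum.remove) auto
  finally have deg: "check_degree B i = \<dots>" .
  have "(\<Sum>l\<in>check_nbrs B i. other_edges B i j l) =
      other_edges B i j j + (\<Sum>l\<in>check_nbrs B i - {j}. other_edges B i j l)"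
    using assms by (intro sum.remove) auto
  also have "(\<Sum>l\<in>check_nbrs B i - {j}. other_edges B i j l) =
      (\<Sum>l\<in>check_nbrs B i - {j}. B $$ (i, l))"
    by (intro sum.cong) (auto simp: other_edges_def)
  finally show ?thesis
    using assms deg by (simp add: other_edges_def check_nbrs_def)
qed

lemma Omega_eq_sum_weights:
  assumes "j \<in> check_nbrs B i"
  shows "Omega B i j s x = (\<Sum>k\<in>erasure_counts B i j s.
    \<Prod>l\<in>check_nbrs B i. binom_weight (other_edges B i j l) (x l) (k l))"
  unfolding Omega_def
proof (rule sum.cong[OF refl])
  fix k
  have "(\<Prod>l\<in>check_nbrs B i. binom_weight (other_edges B i j l) (x l) (k l)) =
      binom_weight (other_edges B i j j) (x j) (k j) *
      (\<Prod>l\<in>check_nbrs B i - {j}. binom_weight (other_edges B i j l) (x l) (k l))"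
    using assms by (intro prod.remove) auto
  also have "(\<Prod>l\<in>check_nbrs B i - {j}. binom_weight (other_edges B i j l) (x l) (k l)) =
      (\<Prod>l\<in>check_nbrs B i - {j}. binom_weight (B $$ (i, l)) (x l) (k l))"
    by (intro prod.cong) (auto simp: other_edges_def)
  finally show "(\<Prod>j'\<in>check_nbrs B i - {j}.
        real (B $$ (i, j') choose k j') * x j' ^ k j' * (1 - x j') ^ (B $$ (i, j') - k j'))
      * (real ((B $$ (i, j) - 1) choose k j) * x j ^ k j * (1 - x j) ^ (B $$ (i, j) - 1 - k j)) =
      (\<Prod>l\<in>check_nbrs B i. binom_weight (other_edges B i j l) (x l) (k l))"
    by (simp add: other_edges_def binom_weight_def mult.commute)
qed

text \<open>
  The truncation at \<open>r - 1\<close> in the update is harmless because \<open>\<zeta>\<^sub>s\<^sub>+\<^sub>1\<^sup>r = 0\<close> for \<open>s \<ge> r\<close>.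
\<close>

lemma sum_Omega_zeta:
  assumes "j \<in> check_nbrs B i" "0 < q" "0 < r"
  shows "(\<Sum>s=0..min (check_degree B i - 1) (r - 1). Omega B i j s x * zeta_coeff q r (s + 1)) =
    recovery_prob B q i j x r"
proof -
  let ?d = "check_degree B i - 1"
  let ?P = "\<Pi>\<^sub>E l\<in>check_nbrs B i. {0..other_edges B i j l}"
  let ?S = "\<lambda>k :: nat \<Rightarrow> nat. \<Sum>l\<in>check_nbrs B i. k l"
  let ?w = "\<lambda>k. \<Prod>l\<in>check_nbrs B i. binom_weight (other_edges B i j l) (x l) (k l)"
  have counts: "erasure_counts B i j s = {k \<in> ?P. ?S k = s}" for s
    unfolding erasure_counts_def other_edges_def ..
  \<comment> \<open>The total count is at most the degree minus one, so grouping the vectors by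
    their total exhausts \<open>?P\<close>.\<close>
  have sub: "?S ` ?P \<subseteq> {0..?d}"
  proof
    fix t assume "t \<in> ?S ` ?P"
    then obtain k where k: "k \<in> ?P" "t = ?S k" by blast
    have "?S k \<le> (\<Sum>l\<in>check_nbrs B i. other_edges B i j l)"
      using k(1) by (intro sum_mono) (auto dest: PiE_mem)
    then show "t \<in> {0..?d}"
      unfolding sum_other_edges[OF assms(1)] k(2) by simp
  qed
  have "(\<Sum>s=0..min ?d (r - 1). Omega B i j s x * zeta_coeff q r (s + 1)) =
      (\<Sum>s=0..?d. Omega B i j s x * zeta_coeff q r (s + 1))"
    using assms by (intro sum.mono_neutral_left) (auto simp: zeta_coeff_eq_0)
  also have "\<dots> = (\<Sum>s=0..?d. \<Sum>k\<in>{k \<in> ?P. ?S k = s}. ?w k * zeta_coeff q r (?S k + 1))"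
    unfolding Omega_eq_sum_weights[OF assms(1)] counts sum_distrib_right
    by (intro sum.cong refl) auto
  also have "\<dots> = (\<Sum>k\<in>?P. ?w k * zeta_coeff q r (?S k + 1))"
    using sub by (intro sum.group finite_PiE) auto
  finally show ?thesis
    unfolding recovery_prob_def count_expect_def .
qed

lemma bcn_update_eq:
  assumes "j \<in> check_nbrs B i" "0 < q"
  shows "bcn_update B M q h x i j = 1 - (\<Sum>r=1..M. h r * recovery_prob B q i j (x i) r)"
  unfolding bcn_update_def
  using assms by (intro arg_cong2[where f = minus] sum.cong refl) (subst sum_Omega_zeta, auto)

section \<open>Monotonicity of recovery probabilities and of averages over the rank\<close>

lemma recovery_prob_bounds:
  assumes "0 < q" "\<And>l. l \<in> check_nbrs B i \<Longrightarrow> 0 \<le> x l" "\<And>l. l \<in> check_nbrs B i \<Longrightarrow> x l \<le> 1"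
  shows "0 \<le> recovery_prob B q i j x r" "recovery_prob B q i j x r \<le> 1"
proof -
  let ?E = "count_expect (check_nbrs B i) (other_edges B i j) x"
  have "?E (\<lambda>_. 0) \<le> recovery_prob B q i j x r"
    unfolding recovery_prob_def using assms zeta_coeff_bounds
    by (intro count_expect_mono) auto
  then show "0 \<le> recovery_prob B q i j x r"
    by (simp add: count_expect_const)
  have "recovery_prob B q i j x r \<le> ?E (\<lambda>_. 1)"
    unfolding recovery_prob_def using assms zeta_coeff_bounds
    by (intro count_expect_mono) auto
  then show "recovery_prob B q i j x r \<le> 1"
    by (simp add: count_expect_const)
qed

text \<open>Rank 0 resolves nothing. This is the boundary value required for summation by
  parts.\<close>

lemma recovery_prob_0 [simp]: "0 < q \<Longrightarrow> recovery_prob B q i j x 0 = 0"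
  by (simp add: recovery_prob_def zeta_coeff_eq_0 count_expect_const)

lemma recovery_prob_mono_rank:
  assumes "0 < q" "r \<le> r'"
    and "\<And>l. l \<in> check_nbrs B i \<Longrightarrow> 0 \<le> x l" "\<And>l. l \<in> check_nbrs B i \<Longrightarrow> x l \<le> 1"
  shows "recovery_prob B q i j x r \<le> recovery_prob B q i j x r'"
  unfolding recovery_prob_def
  using assms by (intro count_expect_mono zeta_coeff_mono_rank) auto

lemma recovery_prob_antimono:
  assumes "0 < q"
    and "\<And>l. l \<in> check_nbrs B i \<Longrightarrow> 0 \<le> x l" "\<And>l. l \<in> check_nbrs B i \<Longrightarrow> x l \<le> x' l"
    and "\<And>l. l \<in> check_nbrs B i \<Longrightarrow> x' l \<le> 1"
  shows "recovery_prob B q i j x' r \<le> recovery_prob B q i j x r"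
proof -
  have "antimono (\<lambda>s. zeta_coeff q r (s + 1))"
    using zeta_coeff_antimono[OF assms(1)] by (auto simp: antimono_def)
  then show ?thesis
    unfolding recovery_prob_def
    using assms by (intro count_expect_antimono) auto
qed

text \<open>Abel summation: since \<open>f 0 = 0\<close>, each \<open>f r\<close> is the sum of its
  increments, which turns the average into tail sums, the quantities compared by
  \<open>rank_le\<close>.\<close>

lemma sum_by_parts_tails:
  fixes f h :: "nat \<Rightarrow> real"
  assumes "f 0 = 0"
  shows "(\<Sum>r=1..M. h r * f r) = (\<Sum>k=1..M. (f k - f (k - 1)) * (\<Sum>i=k..M. h i))"
proof (induction M)
  case 0
  then show ?case by simp
next
  case (Suc M)
  have tele: "(\<Sum>k=1..n. f k - f (k - 1)) = f n" for n
    using assms by (induction n) auto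
  \<comment> \<open>Every tail gains \<open>h (Suc M)\<close>; at \<open>k = Suc M\<close> the old
    tail is the empty sum.\<close>
  have "(\<Sum>k=1..Suc M. (f k - f (k - 1)) * (\<Sum>i=k..Suc M. h i)) =
      (\<Sum>k=1..Suc M. (f k - f (k - 1)) * (\<Sum>i=k..M. h i) + (f k - f (k - 1)) * h (Suc M))"
    by (intro sum.cong refl) (simp add: distrib_left)
  also have "\<dots> = (\<Sum>k=1..M. (f k - f (k - 1)) * (\<Sum>i=k..M. h i)) + f (Suc M) * h (Suc M)"
    unfolding sum.distrib sum_distrib_right[symmetric] tele by simp
  finally show ?case
    using Suc.IH by simp
qed

text \<open>After summation by parts the tails are compared term by term, weighted by the
  nonnegative increments of \<open>f\<close>.\<close>

lemma rank_le_sum_mono: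
  fixes f :: "nat \<Rightarrow> real"
  assumes "rank_le M h' h" "f 0 = 0" "mono f"
  shows "(\<Sum>r=1..M. h' r * f r) \<le> (\<Sum>r=1..M. h r * f r)"
  unfolding sum_by_parts_tails[of f, OF assms(2)]
proof (rule sum_mono, rule mult_left_mono)
  fix k assume "k \<in> {1..M}"
  then show "(\<Sum>i=k..M. h' i) \<le> (\<Sum>i=k..M. h i)"
    using assms(1) by (simp add: rank_le_def)
  show "0 \<le> f k - f (k - 1)"
    using monoD[OF assms(3), of "k - 1" k] by simp
qed

section \<open>Bounds and monotonicity at batch check nodes\<close>

lemma bcn_update_bounds:
  assumes "rank_distribution M h" "0 < q" "j \<in> check_nbrs B i"
    and "\<And>l. l \<in> check_nbrs B i \<Longrightarrow> 0 \<le> x i l" "\<And>l. l \<in> check_nbrs B i \<Longrightarrow> x i l \<le> 1"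
  shows "0 \<le> bcn_update B M q h x i j" "bcn_update B M q h x i j \<le> 1"
proof -
  have h: "0 \<le> h r" if "r \<le> M" for r
    using assms(1) that by (simp add: rank_distribution_def)
  note b = recovery_prob_bounds[of q B i "x i" j, OF assms(2,4,5)]
  have "(\<Sum>r=1..M. h r * recovery_prob B q i j (x i) r) \<le> (\<Sum>r=1..M. h r)"
    using h b by (intro sum_mono mult_left_le) auto
  \<comment> \<open>Adding \<open>h 0\<close> completes the total mass, so the positive ranks carry
    mass at most 1.\<close>
  also have "\<dots> \<le> (\<Sum>r=0..M. h r)"
    using h by (intro sum_mono2) auto
  also have "\<dots> = 1"
    using assms(1) by (simp add: rank_distribution_def)
  finally show "0 \<le> bcn_update B M q h x i j"
    using assms by (simp add: bcn_update_eq)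
  have "0 \<le> (\<Sum>r=1..M. h r * recovery_prob B q i j (x i) r)"
    using h b by (intro sum_nonneg mult_nonneg_nonneg) auto
  then show "bcn_update B M q h x i j \<le> 1"
    using assms by (simp add: bcn_update_eq)
qed

lemma bcn_update_mono:
  assumes "rank_distribution M h" "rank_le M h' h" "0 < q" "j \<in> check_nbrs B i"
    and "\<And>l. l \<in> check_nbrs B i \<Longrightarrow> 0 \<le> x i l"
    and "\<And>l. l \<in> check_nbrs B i \<Longrightarrow> x i l \<le> x' i l"
    and "\<And>l. l \<in> check_nbrs B i \<Longrightarrow> x' i l \<le> 1"
  shows "bcn_update B M q h x i j \<le> bcn_update B M q h' x' i j"
proof -
  have x': "0 \<le> x' i l" if "l \<in> check_nbrs B i" for l
    using assms(5,6)[OF that] by linarith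
  \<comment> \<open>The rank distribution changes first, at the fixed messages \<open>x'\<close>;
    the messages change afterwards, under the nonnegative weights \<open>h\<close>.\<close>
  have "mono (recovery_prob B q i j (x' i))"
    using assms x' by (intro monoI recovery_prob_mono_rank) auto
  then have "(\<Sum>r=1..M. h' r * recovery_prob B q i j (x' i) r) \<le>
      (\<Sum>r=1..M. h r * recovery_prob B q i j (x' i) r)"
    using assms by (intro rank_le_sum_mono) auto
  also have "\<dots> \<le> (\<Sum>r=1..M. h r * recovery_prob B q i j (x i) r)"
    using assms by (intro sum_mono mult_left_mono recovery_prob_antimono)
      (auto simp: rank_distribution_def)
  finally show ?thesis
    using assms by (simp add: bcn_update_eq)
qed

section \<open>Bounds and monotonicity at LDPC check nodes\<close>

lemma lcn_update_bounds:
  assumes "j \<in> check_nbrs B i"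
    and "\<And>l. l \<in> check_nbrs B i \<Longrightarrow> 0 \<le> x i l" "\<And>l. l \<in> check_nbrs B i \<Longrightarrow> x i l \<le> 1"
  shows "0 \<le> lcn_update B x i j" "lcn_update B x i j \<le> 1"
proof -
  let ?p = "\<Prod>l\<in>check_nbrs B i - {j}. (1 - x i l) ^ B $$ (i, l)"
  have "0 \<le> ?p" "?p \<le> 1"
    using assms by (auto intro!: prod_nonneg prod_le_1 power_le_one)
  moreover have "0 \<le> (1 - x i j) ^ (B $$ (i, j) - 1)" "(1 - x i j) ^ (B $$ (i, j) - 1) \<le> 1"
    using assms by (auto intro!: power_le_one)
  ultimately show "0 \<le> lcn_update B x i j" "lcn_update B x i j \<le> 1"
    by (auto simp: lcn_update_def mult_le_one)
qed

text \<open>The factors \<open>1 - x i l\<close> stay nonnegative and shrink as the messages grow,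
  and their product is subtracted from 1.\<close>

lemma lcn_update_mono:
  assumes "j \<in> check_nbrs B i"
    and "\<And>l. l \<in> check_nbrs B i \<Longrightarrow> x i l \<le> x' i l"
    and "\<And>l. l \<in> check_nbrs B i \<Longrightarrow> x' i l \<le> 1"
  shows "lcn_update B x i j \<le> lcn_update B x' i j"
proof -
  have x: "x i l \<le> 1" if "l \<in> check_nbrs B i" for l
    using assms(2,3)[OF that] by linarith
  show ?thesis
    unfolding lcn_update_def using assms x
    by (intro diff_left_mono mult_mono prod_mono conjI power_mono prod_nonneg zero_le_power) auto
qed

section \<open>Density evolution\<close>

lemma cn_update_bounds:
  assumes "rank_distribution M h" "0 < q" "j < dim_col B"
    and "\<And>l. l < dim_col B \<Longrightarrow> 0 \<le> x i l" "\<And>l. l < dim_col B \<Longrightarrow> x i l \<le> 1"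
  shows "0 \<le> cn_update B L M q h x i j" "cn_update B L M q h x i j \<le> 1"
proof -
  have "0 \<le> cn_update B L M q h x i j \<and> cn_update B L M q h x i j \<le> 1"
  proof (cases "B $$ (i, j) = 0")
    case True
    then show ?thesis by (simp add: cn_update_def)
  next
    case False
    then have j: "j \<in> check_nbrs B i" using assms(3) by (simp add: check_nbrs_def)
    have "0 \<le> x i l" "x i l \<le> 1" if "l \<in> check_nbrs B i" for l
      using assms(4,5) that by (auto simp: check_nbrs_def)
    then show ?thesis
      using lcn_update_bounds[OF j, of x] bcn_update_bounds[OF assms(1,2) j, of x] False
      by (simp add: cn_update_def)
  qed
  then show "0 \<le> cn_update B L M q h x i j" "cn_update B L M q h x i j \<le> 1" by auto
qed

lemma cn_update_mono:
  assumes "rank_distribution M h" "rank_le M h' h" "0 < q" "j < dim_col B"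
    and "\<And>l. l < dim_col B \<Longrightarrow> 0 \<le> x i l"
    and "\<And>l. l < dim_col B \<Longrightarrow> x i l \<le> x' i l"
    and "\<And>l. l < dim_col B \<Longrightarrow> x' i l \<le> 1"
  shows "cn_update B L M q h x i j \<le> cn_update B L M q h' x' i j"
proof (cases "B $$ (i, j) = 0")
  case True
  then show ?thesis by (simp add: cn_update_def)
next
  case False
  then have j: "j \<in> check_nbrs B i" using assms(4) by (simp add: check_nbrs_def)
  have "0 \<le> x i l" "x i l \<le> x' i l" "x' i l \<le> 1" if "l \<in> check_nbrs B i" for l
    using assms(5-7) that by (auto simp: check_nbrs_def)
  then show ?thesis
    using lcn_update_mono[OF j, of x x'] bcn_update_mono[OF assms(1-3) j, of x x'] False
    by (simp add: cn_update_def)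
qed

lemma vn_update_bounds:
  assumes "i < dim_row B"
    and "\<And>i. i < dim_row B \<Longrightarrow> 0 \<le> y i j" "\<And>i. i < dim_row B \<Longrightarrow> y i j \<le> 1"
  shows "0 \<le> vn_update B y i j" "vn_update B y i j \<le> 1"
proof -
  let ?p = "\<Prod>i'\<in>var_nbrs B j - {i}. y i' j ^ B $$ (i', j)"
  have "0 \<le> ?p" "?p \<le> 1"
    using assms by (auto intro!: prod_nonneg prod_le_1 power_le_one simp: var_nbrs_def)
  moreover have "0 \<le> y i j ^ (B $$ (i, j) - 1)" "y i j ^ (B $$ (i, j) - 1) \<le> 1"
    using assms by (auto intro!: power_le_one)
  ultimately show "0 \<le> vn_update B y i j" "vn_update B y i j \<le> 1"
    by (auto simp: vn_update_def mult_le_one)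
qed

lemma vn_update_mono:
  assumes "i < dim_row B"
    and "\<And>i. i < dim_row B \<Longrightarrow> 0 \<le> y i j" "\<And>i. i < dim_row B \<Longrightarrow> y i j \<le> y' i j"
  shows "vn_update B y i j \<le> vn_update B y' i j"
proof -
  have y': "0 \<le> y' i j" if "i < dim_row B" for i
    using assms(2,3)[OF that] by linarith
  show ?thesis
    unfolding vn_update_def using assms y'
    by (auto intro!: mult_mono prod_mono power_mono prod_nonneg simp: var_nbrs_def)
qed

lemma de_x_bounds:
  assumes "rank_distribution M h" "0 < q" "i < dim_row B" "j < dim_col B"
  shows "0 \<le> de_x B L M q h l i j \<and> de_x B L M q h l i j \<le> 1"
  using assms(3,4)
proof (induction l arbitrary: i j)
  case 0
  then show ?case by simp
next
  case (Suc l)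
  then show ?case
    using assms(1,2) by (auto intro!: vn_update_bounds cn_update_bounds)
qed

text \<open>At \<open>l = 0\<close> truncated subtraction gives \<open>l - 1 = 0\<close>, so the
  value for \<open>l = 1\<close> is repeated and the bounds hold for every \<open>l\<close>.\<close>

lemma de_y_bounds:
  assumes "rank_distribution M h" "0 < q" "i < dim_row B" "j < dim_col B"
  shows "0 \<le> de_y B L M q h l i j" "de_y B L M q h l i j \<le> 1"
  unfolding de_y_def using assms by (auto intro!: cn_update_bounds simp: de_x_bounds)

text \<open>Both recursions start at 1 and every round preserves the comparison. The dominated
  distribution \<open>h'\<close> gives the larger erasure probabilities.\<close>

lemma de_x_mono:
  assumes "rank_distribution M h" "rank_distribution M h'" "rank_le M h' h" "0 < q"
    and "i < dim_row B" "j < dim_col B"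
  shows "de_x B L M q h l i j \<le> de_x B L M q h' l i j"
  using assms(5,6)
proof (induction l arbitrary: i j)
  case 0
  then show ?case by simp
next
  case (Suc l)
  then show ?case
    using assms(1-4)
    by (auto intro!: vn_update_mono cn_update_mono cn_update_bounds simp: de_x_bounds)
qed

lemma de_z_mono:
  assumes "rank_distribution M h" "rank_distribution M h'" "rank_le M h' h" "0 < q"
    and "j < dim_col B"
  shows "de_z B L M q h l j \<le> de_z B L M q h' l j"
proof -
  have "de_y B L M q h l i j \<le> de_y B L M q h' l i j" if "i < dim_row B" for i
    unfolding de_y_def using assms that
    by (intro cn_update_mono) (auto simp: de_x_bounds de_x_mono)
  then show ?thesis
    unfolding de_z_def using assms
    by (intro prod_mono conjI power_mono zero_le_power)
      (auto simp: var_nbrs_def de_y_bounds)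
qed

lemma de_z_nonneg:
  assumes "rank_distribution M h" "0 < q" "j < dim_col B"
  shows "0 \<le> de_z B L M q h l j"
  unfolding de_z_def using assms
  by (intro prod_nonneg ballI zero_le_power de_y_bounds) (auto simp: var_nbrs_def)

theorem theorem2:
  fixes B :: "nat mat" and L M q :: nat
    and H :: "(nat \<Rightarrow> real) set" and C C' :: real
  assumes "L \<le> dim_row B"
    and "primepow q"
    and "\<And>h. h \<in> H \<Longrightarrow> rank_distribution M h"
    and "admissible M H"
    and "C' \<in> decodable_set B L M q H"
    and "C' < C" and "C \<le> real M"
  shows "C \<in> decodable_set B L M q H"
proof -
  have q: "0 < q"
    using assms(2) by (rule primepow_gt_0_nat)
  have C': "0 \<le> C'"
    using assms(5) by (simp add: decodable_set_def)
  have "(\<lambda>l. de_z B L M q h l j) \<longlonglongrightarrow> 0"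
    if j: "j < dim_col B" and h: "h \<in> rank_dists_at M H C" for j h
  proof -
    \<comment> \<open>Admissibility applies because membership in \<open>decodable_set\<close>
      forces \<open>0 \<le> C'\<close>.\<close>
    obtain h' where h': "h' \<in> rank_dists_at M H C'" "rank_le M h' h"
      using assms(4,6) C' h unfolding admissible_def by (meson less_imp_le)
    have rd: "rank_distribution M h" "rank_distribution M h'"
      using h h'(1) assms(3) by (auto simp: rank_dists_at_def)
    show ?thesis
    \<comment> \<open>The sequence for \<open>h\<close> is squeezed between 0 and the one for
      \<open>h'\<close>, which tends to 0 by the assumption on \<open>C'\<close>.\<close>
    proof (rule tendsto_sandwich[OF always_eventually always_eventually tendsto_const])
      show "(\<lambda>l. de_z B L M q h' l j) \<longlonglongrightarrow> 0"
        using assms(5) j h'(1) by (simp add: decodable_set_def)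
    qed (use de_z_nonneg[OF rd(1) q j] de_z_mono[OF rd h'(2) q j] in auto)
  qed
  then show ?thesis
    using assms(6,7) C' by (simp add: decodable_set_def)
qed

end
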